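(* Let $\Phi:\mathbb{R}^n\to\mathbb{R}\cup\{+\infty\}$ be a function satisfying the structural setting (S) described in the context, with orthogonal decomposition $\mathbb{R}^n=X_1\oplus X_2\oplus X_3$ and $\phi=\Phi|_{X_1}$. Then for all $x=x_1+x_2+x_3$ and $x^*=x_1^*+x_2^*+x_3^*$ in $\mathbb{R}^n$ ($x_i,x_i^*\in X_i$) the following holds: (i) $\partial\Phi(x)=\emptyset$ if $x_3\neq0$, and $\partial\Phi(x)=\partial\phi(x_1)\oplus\{0\}\oplus X_3$ if $x_3=0$. (ii) $\Phi^*(x^* )=\phi^*(x_1^* )$ if $x_2^*=0$, and $\Phi^*(x^* )=+\infty$ if $x_2^*\neq0$. (iii) $\phi^*:X_1\to\mathbb{R}\cup\{+\infty\}$ is proper, convex and lower semicontinuous, essentially smooth and essentially strictly convex; moreover $0\in\operatorname{int}(\operatorname{dom}\phi^* )$ (interior relative to $X_1$) and $0\in\operatorname{ri}(\operatorname{dom}\Phi^* )$.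
   Context: Setting (S): $\mathbb{R}^n=X_1\oplus X_2\oplus X_3$ is a decomposition into pairwise orthogonal subspaces such that $\Phi(x)=\phi(x_1)$ if $x_3=0$ and $\Phi(x)=+\infty$ if $x_3\neq0$, where $\phi=\Phi|_{X_1}:X_1\to\mathbb{R}\cup\{+\infty\}$ fulfills: (i) $\operatorname{dom}\phi$ is an open subset of $X_1$ with $0\in\overline{\operatorname{dom}\phi}$; (ii) $\phi$ is proper, convex, lower semicontinuous, strictly convex and essentially smooth; (iii) $\phi$ has a minimizer. $\operatorname{dom}$ is the set where the function is $<+\infty$; $\operatorname{ri}$ is the relative interior; $\partial$ denotes the convex subdifferential and $^*$ the Fenchel conjugate, for $\Phi$ taken in $\mathbb{R}^n$, for $\phi$ taken in the Euclidean space $X_1$: $\phi^*(p)=\sup_{x\in X_1}\{\langle p,x\rangle-\phi(x)\}$, $p\in X_1$. For subsets $S_i\subseteq X_i$, $S_1\oplus S_2\oplus S_3=\{s_1+s_2+s_3:s_i\in S_i\}$. A convex function on a Euclidean space is essentially smooth if the interior $C$ of its effective domain is nonempty, it is differentiable on $C$, and the norm of its gradient tends to $+\infty$ along every sequence in $C$ converging to a boundary point of $C$. A proper convex function is essentially strictly convex if it is strictly convex on every convex subset of the set of points where its subdifferential is nonempty. *)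

theory Defs
  imports "HOL-Analysis.Analysis"
begin

text \<open>
  A function \<open>X \<rightarrow> \<real> \<union> {+\<infinity>}\<close> on a linear subspace \<open>X\<close> of a Euclidean space is a function
  \<open>f :: 'a \<Rightarrow> ereal\<close> of which only the values on \<open>X\<close> matter. All notions below take \<open>X\<close> as a
  parameter and refer to the inner product and the topology of \<open>X\<close>; \<open>X = UNIV\<close> gives the usual
  notions on the whole space.
\<close>

definition edom :: "'a set \<Rightarrow> ('a \<Rightarrow> ereal) \<Rightarrow> 'a set" where
  "edom X f = {x \<in> X. f x < \<infinity>}"

definition int_edom :: "'a::topological_space set \<Rightarrow> ('a \<Rightarrow> ereal) \<Rightarrow> 'a set" where
  "int_edom X f = top_of_set X interior_of edom X f"

definition proper_fun_on :: "'a set \<Rightarrow> ('a \<Rightarrow> ereal) \<Rightarrow> bool" where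
  "proper_fun_on X f \<longleftrightarrow> (\<forall>x\<in>X. f x \<noteq> -\<infinity>) \<and> (\<exists>x\<in>X. f x < \<infinity>)"

definition convex_fun_on :: "'a::real_vector set \<Rightarrow> ('a \<Rightarrow> ereal) \<Rightarrow> bool" where
  "convex_fun_on X f \<longleftrightarrow>
     (\<forall>x\<in>X. \<forall>y\<in>X. \<forall>t::real. 0 < t \<and> t < 1 \<longrightarrow>
        f ((1 - t) *\<^sub>R x + t *\<^sub>R y) \<le> ereal (1 - t) * f x + ereal t * f y)"

text \<open>To be used with a convex set \<open>S\<close> on which \<open>f\<close> is finite, such as the effective domain.\<close>
definition strictly_convex_fun_on :: "'a::real_vector set \<Rightarrow> ('a \<Rightarrow> ereal) \<Rightarrow> bool" where
  "strictly_convex_fun_on S f \<longleftrightarrow>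
     (\<forall>x\<in>S. \<forall>y\<in>S. \<forall>t::real. x \<noteq> y \<and> 0 < t \<and> t < 1 \<longrightarrow>
        f ((1 - t) *\<^sub>R x + t *\<^sub>R y) < ereal (1 - t) * f x + ereal t * f y)"

definition lsc_fun_on :: "'a::topological_space set \<Rightarrow> ('a \<Rightarrow> ereal) \<Rightarrow> bool" where
  "lsc_fun_on X f \<longleftrightarrow> (\<forall>x\<in>X. f x \<le> Liminf (at x within X) f)"

definition subdifferential :: "'a::real_inner set \<Rightarrow> ('a \<Rightarrow> ereal) \<Rightarrow> 'a \<Rightarrow> 'a set" where
  "subdifferential X f x = {p \<in> X. \<forall>y\<in>X. f x + ereal (p \<bullet> (y - x)) \<le> f y}"

definition conjugate :: "'a::real_inner set \<Rightarrow> ('a \<Rightarrow> ereal) \<Rightarrow> 'a \<Rightarrow> ereal" where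
  "conjugate X f p = (SUP x\<in>X. ereal (p \<bullet> x) - f x)"

text \<open>
  At points of \<open>int_edom X f\<close>, where a proper \<open>f\<close> is finite near \<open>x\<close> in \<open>X\<close>, this is
  differentiability of the restriction to \<open>X\<close>; requiring \<open>g \<in> X\<close> makes the gradient unique.
\<close>
definition has_gradient_on ::
    "'a::euclidean_space set \<Rightarrow> ('a \<Rightarrow> ereal) \<Rightarrow> 'a \<Rightarrow> 'a \<Rightarrow> bool" where
  "has_gradient_on X f x g \<longleftrightarrow>
     g \<in> X \<and> ((\<lambda>y. real_of_ereal (f y)) has_derivative (\<lambda>h. g \<bullet> h)) (at x within X)"

definition essentially_smooth_on :: "'a::euclidean_space set \<Rightarrow> ('a \<Rightarrow> ereal) \<Rightarrow> bool" where
  "essentially_smooth_on X f \<longleftrightarrow>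
     int_edom X f \<noteq> {} \<and>
     (\<forall>x\<in>int_edom X f. \<exists>g. has_gradient_on X f x g) \<and>
     (\<forall>(u::nat \<Rightarrow> 'a) g b.
        (\<forall>k. u k \<in> int_edom X f \<and> has_gradient_on X f (u k) (g k)) \<and>
        u \<longlonglongrightarrow> b \<and> b \<in> top_of_set X frontier_of int_edom X f
        \<longrightarrow> filterlim (\<lambda>k. norm (g k)) at_top sequentially)"

definition essentially_strictly_convex_on ::
    "'a::euclidean_space set \<Rightarrow> ('a \<Rightarrow> ereal) \<Rightarrow> bool" where
  "essentially_strictly_convex_on X f \<longleftrightarrow>
     (\<forall>S. convex S \<and> S \<subseteq> {x \<in> X. subdifferential X f x \<noteq> {}} \<longrightarrow> strictly_convex_fun_on S f)"

text \<open>
  In the last clause \<open>+\<close> is the elementwise sum of sets. Together with pairwise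
  orthogonality it makes the decomposition \<open>x = x1 + x2 + x3\<close> unique.
\<close>
definition orthogonal_decomposition ::
    "'a::euclidean_space set \<Rightarrow> 'a set \<Rightarrow> 'a set \<Rightarrow> bool" where
  "orthogonal_decomposition X1 X2 X3 \<longleftrightarrow>
     subspace X1 \<and> subspace X2 \<and> subspace X3 \<and>
     (\<forall>x\<in>X1. \<forall>y\<in>X2. orthogonal x y) \<and>
     (\<forall>x\<in>X1. \<forall>y\<in>X3. orthogonal x y) \<and>
     (\<forall>x\<in>X2. \<forall>y\<in>X3. orthogonal x y) \<and>
     X1 + X2 + X3 = UNIV"

end

theory Submission
  imports Defs
begin

text \<open>
  Parts (i) and (ii) are computed componentwise. For the conjugate of a strictly convex lower
  semicontinuous \<open>f\<close> on a subspace \<open>X\<close>, the point is that \<open>p\<close> is interior to the domain of the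
  conjugate iff \<open>f - p\<close> grows at least linearly, iff \<open>p\<close> is a subgradient of \<open>f\<close> at some point,
  and that this point is unique. It depends continuously on \<open>p\<close> by compactness, so it is the
  gradient of the conjugate at \<open>p\<close>. If gradients stayed bounded along a sequence tending to a
  boundary point \<open>b\<close>, then \<open>b\<close> would be a subgradient of \<open>f\<close> at an accumulation point, hence
  interior. Strict convexity of the conjugate comes from the uniqueness of the gradient of \<open>f\<close>
  on its open domain.
\<close>

section \<open>Relative interiors, semicontinuity and gradients on a subspace\<close>

lemma int_edom_iff:
  fixes X :: "'a::metric_space set"
  shows "p \<in> int_edom X h \<longleftrightarrow> p \<in> X \<and> (\<exists>r>0. \<forall>q\<in>X. dist q p < r \<longrightarrow> h q < \<infinity>)"
proof
  assume "p \<in> int_edom X h"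
  then obtain T where T: "openin (top_of_set X) T" "p \<in> T" "T \<subseteq> edom X h"
    unfolding int_edom_def interior_of_def by auto
  then show "p \<in> X \<and> (\<exists>r>0. \<forall>q\<in>X. dist q p < r \<longrightarrow> h q < \<infinity>)"
    unfolding openin_euclidean_subtopology_iff edom_def by blast
next
  assume "p \<in> X \<and> (\<exists>r>0. \<forall>q\<in>X. dist q p < r \<longrightarrow> h q < \<infinity>)"
  then obtain r where r: "p \<in> X" "r > 0" "\<forall>q\<in>X. dist q p < r \<longrightarrow> h q < \<infinity>"
    by blast
  have "openin (top_of_set X) (X \<inter> ball p r)"
    by (simp add: openin_open_Int)
  moreover have "X \<inter> ball p r \<subseteq> edom X h"
    using r by (auto simp: edom_def dist_commute)
  ultimately show "p \<in> int_edom X h"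
    unfolding int_edom_def interior_of_def using r by auto
qed

text \<open>Sequential use of lower semicontinuity: the sequences below come with explicit upper
  bounds \<open>c k\<close>, and these pass to the limit without computing any lower limit of
  \<open>f\<close>.\<close>

lemma lsc_fun_on_limit_le:
  fixes X :: "'a::metric_space set"
  assumes "lsc_fun_on X f" "x \<in> X" "\<And>k. u k \<in> X" "u \<longlonglongrightarrow> x"
    and le: "\<And>k. f (u k) \<le> ereal (c k)" and c: "c \<longlonglongrightarrow> l"
  shows "f x \<le> ereal l"
proof (rule ccontr)
  assume "\<not> f x \<le> ereal l"
  then obtain d where d: "ereal l < ereal d" "ereal d < f x"
    by (metis ereal_dense2 not_le)
  have "f x \<le> Liminf (at x within X) f"
    using assms by (auto simp: lsc_fun_on_def)
  then have "eventually (\<lambda>y. ereal d < f y) (at x within X)"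
    using d(2) unfolding le_Liminf_iff by blast
  then obtain e where e: "e > 0" "\<And>y. y \<in> X \<Longrightarrow> y \<noteq> x \<Longrightarrow> dist y x < e \<Longrightarrow> ereal d < f y"
    unfolding eventually_at by blast
  have "\<forall>\<^sub>F k in sequentially. dist (u k) x < e"
    using assms(4) e(1) by (auto simp: tendsto_iff)
  moreover have "\<forall>\<^sub>F k in sequentially. c k < d"
    using order_tendstoD(2)[OF c] d(1) by simp
  ultimately have "\<forall>\<^sub>F k in sequentially. False"
  proof eventually_elim
    case (elim k)
    \<comment> \<open>The filter \<open>at x within X\<close> omits \<open>x\<close> itself, so
      terms of the sequence equal to \<open>x\<close> rely on \<open>d < f x\<close>
      instead.\<close>
    have "ereal d < f (u k)"
      using e(2)[of "u k"] elim(1) d(2) assms(3) by (cases "u k = x") auto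
    then show False
      using le[of k] elim(2)
      by (meson ereal_less_eq(3) less_imp_le not_le order_trans less_le_trans)
  qed
  then show False by simp
qed

text \<open>Along the direction \<open>p - g\<close>, which lies in \<open>X\<close>, the
  subgradient forces slope at least \<open>p \<bullet> (p - g)\<close>, while the derivative allows
  only \<open>g \<bullet> (p - g)\<close> up to a small error.\<close>

lemma has_gradient_on_unique:
  fixes X :: "'a::euclidean_space set"
  assumes X: "subspace X" and grad: "has_gradient_on X f x g"
    and p: "p \<in> subdifferential X f x" and x: "x \<in> int_edom X f"
    and notm: "\<And>y. y \<in> X \<Longrightarrow> f y \<noteq> -\<infinity>"
  shows "p = g"
proof -
  define h where "h = p - g"
  have hX: "h \<in> X"
    using X grad p by (auto simp: h_def has_gradient_on_def subdifferential_def subspace_diff)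
  obtain r where xX: "x \<in> X" and r: "r > 0" "\<And>q. q \<in> X \<Longrightarrow> dist q x < r \<Longrightarrow> f q < \<infinity>"
    using x unfolding int_edom_iff by blast
  define F where "F = (\<lambda>y. real_of_ereal (f y))"
  have F: "f q = ereal (F q)" if "q \<in> X" "dist q x < r" for q
    using r(2)[OF that] notm[OF that(1)] by (cases "f q") (auto simp: F_def)
  have "(F has_derivative (\<lambda>h. g \<bullet> h)) (at x within X)"
    using grad by (simp add: has_gradient_on_def F_def)
  then have lim: "\<And>e. e > 0 \<Longrightarrow> \<exists>d>0. \<forall>y\<in>X. norm (y - x) < d \<longrightarrow>
      norm (F y - F x - g \<bullet> (y - x)) \<le> e * norm (y - x)"
    unfolding has_derivative_within_alt by blast
  show ?thesis
  proof (rule ccontr)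
    assume "p \<noteq> g"
    then have hpos: "norm h > 0" by (simp add: h_def)
    obtain d where d: "d > 0" "\<And>y. y \<in> X \<Longrightarrow> norm (y - x) < d \<Longrightarrow>
      norm (F y - F x - g \<bullet> (y - x)) \<le> (norm h / 2) * norm (y - x)"
      using lim[of "norm h / 2"] hpos by auto
    \<comment> \<open>This step length keeps \<open>y\<close> where \<open>f\<close> is finite and
      where the derivative estimate holds. The two linear terms then differ by
      \<open>s * norm h * norm h\<close>, twice the error that the tolerance
      \<open>norm h / 2\<close> permits.\<close>
    define s where "s = min d r / (2 * norm h)"
    have s: "s > 0" "s * norm h < d" "s * norm h < r"
      using hpos d(1) r(1) by (auto simp: s_def min_def)
    define y where "y = x + s *\<^sub>R h"
    have yX: "y \<in> X" using X xX hX by (simp add: y_def subspace_add subspace_scale)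
    have ny: "norm (y - x) = s * norm h" using s by (simp add: y_def)
    have fy: "f y = ereal (F y)" using F[OF yX] ny s by (simp add: dist_norm)
    have fx: "f x = ereal (F x)" using F[OF xX] r by simp
    have "f x + ereal (p \<bullet> (y - x)) \<le> f y"
      using p yX by (auto simp: subdifferential_def)
    then have 1: "F x + p \<bullet> (y - x) \<le> F y" by (simp add: fx fy)
    have 2: "F y - F x - g \<bullet> (y - x) \<le> (norm h / 2) * (s * norm h)"
      using d(2)[OF yX] ny s unfolding real_norm_def abs_le_iff by auto
    have "(p - g) \<bullet> (y - x) = s * (norm h * norm h)"
      by (simp add: y_def h_def power2_norm_eq_inner flip: power2_eq_square)
    then have "s * (norm h * norm h) \<le> (norm h / 2) * (s * norm h)"
      using 1 2 unfolding inner_diff_left by linarith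
    moreover have "s * (norm h * norm h) > 0" using s hpos by simp
    ultimately show False by (simp add: mult.assoc mult.left_commute)
  qed
qed

section \<open>Conjugates of proper functions\<close>

lemma conjugate_upper:
  "x \<in> X \<Longrightarrow> ereal (p \<bullet> x) - f x \<le> conjugate X f p"
  unfolding conjugate_def by (rule SUP_upper)

text \<open>Trades the supremum and its extended-real subtraction for affine minorants of
  \<open>f\<close>, the form in which bounds on the conjugate are used later.\<close>

lemma conjugate_le_iff:
  assumes "proper_fun_on X f"
  shows "conjugate X f p \<le> ereal c \<longleftrightarrow> (\<forall>x\<in>X. ereal (p \<bullet> x - c) \<le> f x)"
proof -
  have "ereal (p \<bullet> x) - f x \<le> ereal c \<longleftrightarrow> ereal (p \<bullet> x - c) \<le> f x" if "x \<in> X" for x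
    using assms that by (cases "f x") (auto simp: proper_fun_on_def algebra_simps)
  then show ?thesis
    unfolding conjugate_def SUP_le_iff by blast
qed

text \<open>Averaging an affine minorant of slope \<open>p\<close> with one of slope
  \<open>q\<close> gives an affine minorant of the averaged slope. Infinite values are split off
  first; there the absence of \<open>-\<infinity>\<close> makes the right-hand side
  infinite.\<close>

lemma conjugate_convex:
  fixes X :: "'a::real_inner set"
  assumes "proper_fun_on X f"
  shows "convex_fun_on X (conjugate X f)"
  unfolding convex_fun_on_def
proof (intro ballI allI impI)
  fix p q :: 'a and t :: real
  assume pq: "p \<in> X" "q \<in> X" and t: "0 < t \<and> t < 1"
  have nf: "\<And>x. x \<in> X \<Longrightarrow> f x \<noteq> -\<infinity>"
    using assms by (auto simp: proper_fun_on_def)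
  have nc: "conjugate X f p \<noteq> -\<infinity>" for p
  proof -
    obtain x where x: "x \<in> X" "f x < \<infinity>" using assms by (auto simp: proper_fun_on_def)
    then show ?thesis using conjugate_upper[OF x(1), of p f] nf[OF x(1)]
      by (cases "f x") auto
  qed
  show "conjugate X f ((1 - t) *\<^sub>R p + t *\<^sub>R q)
      \<le> ereal (1 - t) * conjugate X f p + ereal t * conjugate X f q"
  proof (cases "conjugate X f p = \<infinity> \<or> conjugate X f q = \<infinity>")
    case True
    then show ?thesis using t nc[of p] nc[of q]
      by (cases "conjugate X f p"; cases "conjugate X f q") auto
  next
    case False
    then obtain a b where ab: "conjugate X f p = ereal a" "conjugate X f q = ereal b"
      using nc by (metis ereal_cases)
    have "conjugate X f ((1 - t) *\<^sub>R p + t *\<^sub>R q) \<le> ereal ((1 - t) * a + t * b)"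
      unfolding conjugate_le_iff[OF assms]
    proof
      fix x assume x: "x \<in> X"
      have "ereal (p \<bullet> x - a) \<le> f x" "ereal (q \<bullet> x - b) \<le> f x"
        using ab conjugate_le_iff[OF assms, of p a] conjugate_le_iff[OF assms, of q b] x by auto
      then show "ereal (((1 - t) *\<^sub>R p + t *\<^sub>R q) \<bullet> x - ((1 - t) * a + t * b)) \<le> f x"
      proof (cases "f x")
        case (real v)
        then have v: "p \<bullet> x - a \<le> v" "q \<bullet> x - b \<le> v"
          using \<open>ereal (p \<bullet> x - a) \<le> f x\<close> \<open>ereal (q \<bullet> x - b) \<le> f x\<close> by auto
        have "(1 - t) * (p \<bullet> x - a) + t * (q \<bullet> x - b) \<le> (1 - t) * v + t * v"
          using v t by (intro add_mono mult_left_mono) auto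
        then show ?thesis using real by (simp add: algebra_simps)
      qed (use nf[OF x] in auto)
    qed
    then show ?thesis by (simp add: ab)
  qed
qed

text \<open>A point \<open>x\<close> whose term in the supremum exceeds \<open>y\<close> at
  \<open>p\<close> still does so at nearby \<open>q\<close>, because that term is continuous in the
  slope.\<close>

lemma conjugate_lsc:
  fixes X :: "'a::real_inner set"
  shows "lsc_fun_on X (conjugate X f)"
  unfolding lsc_fun_on_def
proof
  fix p assume "p \<in> X"
  show "conjugate X f p \<le> Liminf (at p within X) (conjugate X f)"
    unfolding le_Liminf_iff
  proof (intro allI impI)
    fix y assume "y < conjugate X f p"
    then obtain x where x: "x \<in> X" "y < ereal (p \<bullet> x) - f x"
      unfolding conjugate_def less_SUP_iff by blast
    have "\<forall>\<^sub>F q in at p within X. y < ereal (q \<bullet> x) - f x"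
    proof (cases "f x")
      case (real v)
      have "((\<lambda>q. ereal (q \<bullet> x - v)) \<longlongrightarrow> ereal (p \<bullet> x - v)) (at p within X)"
        by (intro tendsto_intros)
      then show ?thesis using order_tendstoD(1) x(2) real by fastforce
    qed (use x in auto)
    then show "\<forall>\<^sub>F q in at p within X. y < conjugate X f q"
      by eventually_elim (use conjugate_upper[OF x(1)] less_le_trans in blast)
  qed
qed


section \<open>Subgradients of a strictly convex lower semicontinuous function\<close>

locale strictly_convex_lsc =
  fixes X :: "'a::euclidean_space set" and f :: "'a \<Rightarrow> ereal"
  assumes subspace: "subspace X"
    and proper: "proper_fun_on X f"
    and convex: "convex_fun_on X f"
    and lsc: "lsc_fun_on X f"
    and strict: "strictly_convex_fun_on (edom X f) f"
begin

lemma closed: "closed X"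
  by (rule closed_subspace[OF subspace])

lemma not_minf: "x \<in> X \<Longrightarrow> f x \<noteq> -\<infinity>"
  using proper by (auto simp: proper_fun_on_def)

lemma finite_point:
  obtains z v where "z \<in> X" "f z = ereal v"
proof -
  obtain z where "z \<in> X" "f z < \<infinity>" using proper by (auto simp: proper_fun_on_def)
  then show thesis using not_minf[of z] that by (cases "f z") auto
qed

lemma subdifferentialE:
  assumes "p \<in> subdifferential X f x" "x \<in> X"
  obtains a where "f x = ereal a" "p \<in> X" "\<And>y. y \<in> X \<Longrightarrow> ereal (a + p \<bullet> (y - x)) \<le> f y"
proof -
  have le: "f x + ereal (p \<bullet> (y - x)) \<le> f y" if "y \<in> X" for y
    using assms that by (auto simp: subdifferential_def)
  \<comment> \<open>Testing the inequality at a point where \<open>f\<close> is finite rules out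
    \<open>f x = \<infinity>\<close>.\<close>
  obtain z v where z: "z \<in> X" "f z = ereal v" using finite_point .
  obtain a where a: "f x = ereal a"
    using le[OF z(1)] z(2) not_minf[OF assms(2)] by (cases "f x") auto
  show thesis
    using le assms(1) by (intro that[OF a]) (auto simp: subdifferential_def a)
qed

lemma subdifferentialI:
  assumes "p \<in> X" "f x = ereal a" "\<And>y. y \<in> X \<Longrightarrow> ereal (a + p \<bullet> (y - x)) \<le> f y"
  shows "p \<in> subdifferential X f x"
  using assms by (auto simp: subdifferential_def)

text \<open>The equality case of the Fenchel-Young inequality: an affine minorant touching
  \<open>f\<close> at \<open>x\<close> is the highest one of its slope.\<close>

lemma conjugate_eq:
  assumes "p \<in> subdifferential X f x" "x \<in> X" "f x = ereal a"
  shows "conjugate X f p = ereal (p \<bullet> x - a)"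
proof (rule antisym)
  have "\<forall>y\<in>X. ereal (a + p \<bullet> (y - x)) \<le> f y"
    using assms by (auto simp: subdifferential_def)
  then show "conjugate X f p \<le> ereal (p \<bullet> x - a)"
    unfolding conjugate_le_iff[OF proper] by (simp add: inner_diff_right algebra_simps)
  show "ereal (p \<bullet> x - a) \<le> conjugate X f p"
    using conjugate_upper[OF assms(2), of p f] assms(3) by simp
qed

text \<open>One half of the inversion between the two subdifferentials. At interior points,
  uniqueness of the gradient gives the converse in
  \<open>conjugate_gradient_subdifferential\<close>.\<close>

lemma subdifferential_conjugateI:
  assumes "p \<in> subdifferential X f x" "x \<in> X"
  shows "x \<in> subdifferential X (conjugate X f) p"
proof -
  obtain a where a: "f x = ereal a" using subdifferentialE[OF assms] .
  have "ereal (p \<bullet> x - a) + ereal (x \<bullet> (q - p)) \<le> conjugate X f q" if "q \<in> X" for q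
    using conjugate_upper[OF assms(2), of q f] a
    by (simp add: inner_diff_right inner_commute)
  then show ?thesis
    using assms(2) conjugate_eq[OF assms a] by (auto simp: subdifferential_def)
qed

lemma conjugate_not_minf: "conjugate X f p \<noteq> -\<infinity>"
proof -
  obtain z v where z: "z \<in> X" "f z = ereal v" using finite_point .
  then show ?thesis using conjugate_upper[OF z(1), of p f] by auto
qed

lemma convexD:
  assumes "x \<in> X" "y \<in> X" "0 < t" "t < 1" "f x = ereal a" "f y = ereal b"
  shows "f ((1 - t) *\<^sub>R x + t *\<^sub>R y) \<le> ereal ((1 - t) * a + t * b)"
  using convex assms unfolding convex_fun_on_def by fastforce

text \<open>At the midpoint \<open>z\<close> strict convexity puts \<open>f z\<close> below the
  average of the two values. The two supporting affine functions at \<open>z\<close> sum to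
  \<open>a + b\<close>, since their linear parts cancel there, so they cannot both stay below
  \<open>f z\<close>.\<close>

lemma subdifferential_inj:
  assumes x: "p \<in> subdifferential X f x" "x \<in> X" and y: "p \<in> subdifferential X f y" "y \<in> X"
  shows "x = y"
proof (rule ccontr)
  assume ne: "x \<noteq> y"
  obtain a where a: "f x = ereal a" "\<And>z. z \<in> X \<Longrightarrow> ereal (a + p \<bullet> (z - x)) \<le> f z"
    using subdifferentialE[OF x] by metis
  obtain b where b: "f y = ereal b" "\<And>z. z \<in> X \<Longrightarrow> ereal (b + p \<bullet> (z - y)) \<le> f z"
    using subdifferentialE[OF y] by metis
  define z where "z = (1 - 1/2) *\<^sub>R x + (1/2) *\<^sub>R y"
  have zX: "z \<in> X" using subspace x y by (simp add: z_def subspace_add subspace_scale)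
  have "x \<in> edom X f" "y \<in> edom X f" using a b x y by (auto simp: edom_def)
  then have "f z < ereal (1 - 1/2) * f x + ereal (1/2) * f y"
    using strict ne unfolding z_def strictly_convex_fun_on_def
    by (metis half_gt_zero_iff less_numeral_extra(1) field_sum_of_halves less_add_same_cancel1)
  then have lt: "f z < ereal ((a + b) / 2)" by (simp add: a b add_divide_distrib)
  have "ereal (a + p \<bullet> (z - x)) < ereal ((a + b) / 2)" "ereal (b + p \<bullet> (z - y)) < ereal ((a + b) / 2)"
    using le_less_trans[OF a(2)[OF zX] lt] le_less_trans[OF b(2)[OF zX] lt] .
  then have "(a + p \<bullet> (z - x)) + (b + p \<bullet> (z - y)) < a + b" by simp
  moreover have "p \<bullet> (z - x) + p \<bullet> (z - y) = 0"
    by (simp add: z_def inner_diff_right inner_add_right algebra_simps)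
  ultimately show False by simp
qed

text \<open>For fixed \<open>y\<close> the subgradient inequality bounds \<open>f (u k)\<close>
  above by a convergent sequence, so lower semicontinuity bounds \<open>f x\<close>. Applied to a
  point of finite value this shows that \<open>f x\<close> is finite; applied to every
  \<open>y\<close> it is the subgradient inequality at \<open>x\<close>.\<close>

lemma subdifferential_closed_graph:
  assumes P: "\<And>k. P k \<in> subdifferential X f (u k)" "\<And>k. u k \<in> X"
    and lim: "P \<longlonglongrightarrow> p" "u \<longlonglongrightarrow> x"
  shows "x \<in> X" "p \<in> subdifferential X f x"
proof -
  have PX: "P k \<in> X" for k using P(1)[of k] by (auto simp: subdifferential_def)
  show xX: "x \<in> X" using closed P(2) lim(2) by (rule closed_sequentially)
  have pX: "p \<in> X" using closed PX lim(1) by (rule closed_sequentially)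
  have *: "f x \<le> ereal (b - p \<bullet> (y - x))" if y: "y \<in> X" "f y = ereal b" for y b
  proof (rule lsc_fun_on_limit_le[OF lsc xX P(2) lim(2)])
    fix k
    obtain a where "f (u k) = ereal a" "\<And>y. y \<in> X \<Longrightarrow> ereal (a + P k \<bullet> (y - u k)) \<le> f y"
      using subdifferentialE[OF P(1) P(2)] by metis
    then show "f (u k) \<le> ereal (b - P k \<bullet> (y - u k))" using y by fastforce
  next
    show "(\<lambda>k. b - P k \<bullet> (y - u k)) \<longlonglongrightarrow> b - p \<bullet> (y - x)"
      by (intro tendsto_intros lim)
  qed
  obtain z v where z: "z \<in> X" "f z = ereal v" using finite_point .
  obtain a where a: "f x = ereal a" using *[OF z] not_minf[OF xX] by (cases "f x") auto
  show "p \<in> subdifferential X f x"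
  proof (rule subdifferentialI[OF pX a])
    fix y assume y: "y \<in> X"
    then show "ereal (a + p \<bullet> (y - x)) \<le> f y"
      using *[OF y] not_minf[OF y] a by (cases "f y") auto
  qed
qed

section \<open>Linear growth and the interior of the domain of the conjugate\<close>

text \<open>By Cauchy-Schwarz the growth term absorbs any change of slope smaller than
  \<open>\<rho>\<close>, so one constant \<open>M\<close> bounds the conjugate on a whole
  ball.\<close>

lemma int_edom_conjugateI:
  assumes "p \<in> X" "\<rho> > 0" "\<And>x. x \<in> X \<Longrightarrow> ereal (p \<bullet> x + \<rho> * norm x - M) \<le> f x"
  shows "p \<in> int_edom X (conjugate X f)"
  unfolding int_edom_iff
proof (intro conjI exI[of _ \<rho>] ballI impI)
  fix q assume q: "q \<in> X" "dist q p < \<rho>"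
  have "conjugate X f q \<le> ereal M"
    unfolding conjugate_le_iff[OF proper]
  proof
    fix x assume x: "x \<in> X"
    have "(q - p) \<bullet> x \<le> norm (q - p) * norm x" by (rule norm_cauchy_schwarz)
    also have "\<dots> \<le> \<rho> * norm x" using q by (intro mult_right_mono) (auto simp: dist_norm)
    finally have "ereal (q \<bullet> x - M) \<le> ereal (p \<bullet> x + \<rho> * norm x - M)"
      by (simp add: inner_diff_left)
    then show "ereal (q \<bullet> x - M) \<le> f x" using assms(3)[OF x] order_trans by blast
  qed
  then show "conjugate X f q < \<infinity>" by auto
qed (use assms in auto)

text \<open>Finiteness of the conjugate on both sides of \<open>p\<close> in finitely many
  directions already gives linear growth: each pair of affine minorants controls one coordinate of
  \<open>x\<close>, and averaging over the basis controls the norm.\<close>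

lemma int_edom_conjugateE:
  assumes "p \<in> int_edom X (conjugate X f)"
  obtains \<rho> M where "\<rho> > 0" "\<And>x. x \<in> X \<Longrightarrow> ereal (p \<bullet> x + \<rho> * norm x - M) \<le> f x"
proof -
  obtain r where pX: "p \<in> X" and r: "r > 0" "\<And>q. q \<in> X \<Longrightarrow> dist q p < r \<Longrightarrow> conjugate X f q < \<infinity>"
    using assms unfolding int_edom_iff by blast
  define s where "s = r / 2"
  have s: "s > 0" "s < r" using r by (auto simp: s_def)
  have "\<exists>M. \<forall>x\<in>X. ereal (p \<bullet> x + s * \<bar>x \<bullet> b\<bar> - M) \<le> f x" if b: "b \<in> Basis" for b
  proof -
    \<comment> \<open>The basis is that of the ambient space, so \<open>b\<close> is replaced by its
      orthogonal projection \<open>y\<close> onto \<open>X\<close>. It has the same inner products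
      with points of \<open>X\<close>, and norm at most 1, so a step of size \<open>s\<close> along
      it stays within distance \<open>r\<close> of \<open>p\<close>.\<close>
    obtain y z where yz: "y \<in> span X" "\<And>w. w \<in> span X \<Longrightarrow> orthogonal z w" "b = y + z"
      using orthogonal_subspace_decomp_exists[of X b] by metis
    have yX: "y \<in> X" using yz(1) span_eq_iff[THEN iffD2, OF subspace] by simp
    have yb: "x \<bullet> b = y \<bullet> x" if "x \<in> X" for x
      using yz(2)[of x] that
      by (simp add: yz(3) span_base orthogonal_def inner_add_right inner_commute)
    have "(norm b)\<^sup>2 = (norm y)\<^sup>2 + (norm z)\<^sup>2"
      unfolding yz(3) using yz(1,2) by (intro norm_add_Pythagorean) (simp add: orthogonal_commute)
    then have "(norm y)\<^sup>2 + (norm z)\<^sup>2 = 1" using b by simp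
    then have "(norm y)\<^sup>2 \<le> 1\<^sup>2"
      using zero_le_power2[of "norm z"] unfolding one_power2 by linarith
    then have ny: "norm y \<le> 1" by (rule power2_le_imp_le) simp
    have fin: "\<exists>c. conjugate X f (p + \<sigma> *\<^sub>R y) = ereal c" if "\<bar>\<sigma>\<bar> = s" for \<sigma>
    proof -
      have "\<bar>\<sigma>\<bar> * norm y \<le> s * 1" using that s ny by (intro mult_mono) auto
      then have "conjugate X f (p + \<sigma> *\<^sub>R y) < \<infinity>"
        using s pX yX subspace by (intro r(2)) (auto simp: dist_norm subspace_add subspace_scale)
      then show ?thesis using conjugate_not_minf[of "p + \<sigma> *\<^sub>R y"]
        by (cases "conjugate X f (p + \<sigma> *\<^sub>R y)") auto
    qed
    obtain c where c: "conjugate X f (p + s *\<^sub>R y) = ereal c" using fin[of s] s by auto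
    obtain d where d: "conjugate X f (p + (-s) *\<^sub>R y) = ereal d" using fin[of "-s"] s by auto
    have "ereal (p \<bullet> x + s * \<bar>x \<bullet> b\<bar> - max c d) \<le> f x" if x: "x \<in> X" for x
    proof -
      have "ereal ((p + s *\<^sub>R y) \<bullet> x - c) \<le> f x" "ereal ((p + (-s) *\<^sub>R y) \<bullet> x - d) \<le> f x"
        using c d conjugate_le_iff[OF proper, of "p + s *\<^sub>R y" c]
          conjugate_le_iff[OF proper, of "p + (-s) *\<^sub>R y" d] x by auto
      moreover have "p \<bullet> x + s * \<bar>x \<bullet> b\<bar> - max c d \<le> (p + s *\<^sub>R y) \<bullet> x - c \<or>
          p \<bullet> x + s * \<bar>x \<bullet> b\<bar> - max c d \<le> (p + (-s) *\<^sub>R y) \<bullet> x - d"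
        by (auto simp: yb[OF x] inner_add_left inner_diff_left abs_if)
      ultimately show ?thesis by (metis ereal_less_eq(3) order_trans)
    qed
    then show ?thesis by blast
  qed
  then obtain m where m: "\<And>b x. b \<in> Basis \<Longrightarrow> x \<in> X \<Longrightarrow> ereal (p \<bullet> x + s * \<bar>x \<bullet> b\<bar> - m b) \<le> f x"
    by metis
  define d where "d = real DIM('a)"
  have d: "d > 0" by (simp add: d_def)
  show thesis
  proof (rule that)
    \<comment> \<open>The \<open>d\<close> coordinate bounds are averaged; the sum of the absolute
      coordinates dominates the norm, which leaves the rate \<open>s / d\<close>.\<close>
    show "s / d > 0" using s d by simp
    fix x assume x: "x \<in> X"
    show "ereal (p \<bullet> x + (s / d) * norm x - (\<Sum>b\<in>Basis. m b) / d) \<le> f x"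
    proof (cases "f x")
      case (real v)
      have "s * \<bar>x \<bullet> b\<bar> \<le> (v - p \<bullet> x) + m b" if "b \<in> Basis" for b
        using m[OF that x] real by simp
      then have "(\<Sum>b\<in>Basis. s * \<bar>x \<bullet> b\<bar>) \<le> (\<Sum>b\<in>(Basis::'a set). (v - p \<bullet> x) + m b)"
        by (rule sum_mono)
      also have "\<dots> = d * (v - p \<bullet> x) + (\<Sum>b\<in>Basis. m b)"
        by (simp add: sum.distrib d_def)
      finally have "s * (\<Sum>b\<in>Basis. \<bar>x \<bullet> b\<bar>) \<le> d * (v - p \<bullet> x) + (\<Sum>b\<in>Basis. m b)"
        by (simp add: sum_distrib_left)
      moreover have "s * norm x \<le> s * (\<Sum>b\<in>Basis. \<bar>x \<bullet> b\<bar>)"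
        using s by (intro mult_left_mono norm_le_l1) auto
      ultimately have "s * norm x \<le> d * (v - p \<bullet> x) + (\<Sum>b\<in>Basis. m b)" by simp
      then have "(d * (p \<bullet> x) + s * norm x - (\<Sum>b\<in>Basis. m b)) / d \<le> v"
        using d by (simp add: pos_divide_le_eq algebra_simps)
      then show ?thesis using d real by (simp add: add_divide_distrib diff_divide_distrib)
    qed (use not_minf[OF x] in auto)
  qed
qed

text \<open>A maximizing sequence for the supremum defining the conjugate is bounded because
  \<open>f - p\<close> grows linearly. Lower semicontinuity makes an accumulation point attain the
  supremum, and there the best affine minorant of slope \<open>p\<close> touches
  \<open>f\<close>.\<close>

lemma subdifferential_exists:
  assumes "p \<in> int_edom X (conjugate X f)"
  obtains x where "x \<in> X" "p \<in> subdifferential X f x"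
proof -
  have pX: "p \<in> X" and "conjugate X f p < \<infinity>"
    using assms unfolding int_edom_iff by auto
  then obtain c where c: "conjugate X f p = ereal c"
    using conjugate_not_minf[of p] by (cases "conjugate X f p") auto
  obtain \<rho> M where \<rho>: "\<rho> > 0" "\<And>x. x \<in> X \<Longrightarrow> ereal (p \<bullet> x + \<rho> * norm x - M) \<le> f x"
    using int_edom_conjugateE[OF assms] by metis
  have "\<exists>x\<in>X. f x \<le> ereal (p \<bullet> x - c + inverse (real (Suc k)))" for k
  proof -
    have "ereal (c - inverse (real (Suc k))) < conjugate X f p"
      unfolding c by simp
    then obtain x where "x \<in> X" "ereal (c - inverse (real (Suc k))) < ereal (p \<bullet> x) - f x"
      unfolding conjugate_def less_SUP_iff by blast
    then show ?thesis using not_minf[of x] by (cases "f x") (auto intro!: bexI[of _ x])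
  qed
  then obtain u where u: "\<And>k. u k \<in> X"
      "\<And>k. f (u k) \<le> ereal (p \<bullet> u k - c + inverse (real (Suc k)))"
    by metis
  \<comment> \<open>Linear growth bounds \<open>f (u k)\<close> below and near-maximality bounds it
    above; the linear terms cancel and only the norm remains.\<close>
  have "norm (u k) \<le> (M - c + 1) / \<rho>" for k
  proof -
    have "ereal (p \<bullet> u k + \<rho> * norm (u k) - M) \<le> ereal (p \<bullet> u k - c + inverse (real (Suc k)))"
      using \<rho>(2)[OF u(1)] u(2) by (rule order_trans)
    moreover have "inverse (real (Suc k)) \<le> 1" by (simp add: inverse_le_1_iff)
    ultimately have "\<rho> * norm (u k) \<le> M - c + 1" by (simp del: of_nat_Suc)
    then show ?thesis using \<rho>(1) by (simp add: field_simps)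
  qed
  then have "bounded (range u)" unfolding bounded_iff by blast
  then obtain x r where r: "strict_mono (r :: nat \<Rightarrow> nat)" "(u \<circ> r) \<longlonglongrightarrow> x"
    using bounded_imp_convergent_subsequence by blast
  have xX: "x \<in> X" using closed _ r(2) by (rule closed_sequentially) (simp add: u)
  have "f x \<le> ereal (p \<bullet> x - c + 0)"
  proof (rule lsc_fun_on_limit_le[OF lsc xX _ r(2)])
    show "f ((u \<circ> r) k) \<le> ereal (p \<bullet> (u \<circ> r) k - c + inverse (real (Suc (r k))))" for k
      using u(2)[of "r k"] by (simp del: of_nat_Suc)
    have "(\<lambda>k. inverse (real (Suc (r k)))) \<longlonglongrightarrow> 0"
      using LIMSEQ_subseq_LIMSEQ[OF LIMSEQ_inverse_real_of_nat r(1)] by (simp add: o_def)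
    then show "(\<lambda>k. p \<bullet> (u \<circ> r) k - c + inverse (real (Suc (r k)))) \<longlonglongrightarrow> p \<bullet> x - c + 0"
      by (intro tendsto_intros r(2))
  qed (simp add: u)
  then have le: "f x \<le> ereal (p \<bullet> x - c)" by simp
  then obtain a where a: "f x = ereal a" using not_minf[OF xX] by (cases "f x") auto
  have "p \<in> subdifferential X f x"
  proof (rule subdifferentialI[OF pX a])
    fix y assume "y \<in> X"
    then have "ereal (p \<bullet> y - c) \<le> f y"
      using c conjugate_le_iff[OF proper, of p c] by auto
    then show "ereal (a + p \<bullet> (y - x)) \<le> f y"
      by (rule order_trans[rotated]) (use le a in \<open>simp add: inner_diff_right\<close>)
  qed
  then show thesis using that xX by blast
qed

text \<open>Strict convexity makes \<open>f - p\<close> grow linearly away from its unique minimizer \<open>x\<close>, because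
  the growth on the unit sphere around \<open>x\<close> propagates outwards along rays.\<close>
lemma subdifferential_imp_int_edom_conjugate:
  assumes px: "p \<in> subdifferential X f x" "x \<in> X"
  shows "p \<in> int_edom X (conjugate X f)"
proof -
  obtain a where a: "f x = ereal a" and pX: "p \<in> X"
    and sub: "\<And>y. y \<in> X \<Longrightarrow> ereal (a + p \<bullet> (y - x)) \<le> f y"
    using subdifferentialE[OF px] by metis
  \<comment> \<open>Compactness of the unit sphere: without a uniform gap, some \<open>y\<close> at
    distance 1 from \<open>x\<close> would satisfy the supporting inequality with equality. Then
    \<open>p\<close> would be a subgradient at \<open>y\<close> as well, against
    \<open>subdifferential_inj\<close>.\<close>
  have "\<exists>\<delta>>0. \<forall>y\<in>X. norm (y - x) = 1 \<longrightarrow> ereal (a + p \<bullet> (y - x) + \<delta>) \<le> f y"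
  proof (rule ccontr)
    assume "\<not> ?thesis"
    then have "\<And>\<delta>. \<delta> > 0 \<Longrightarrow> \<exists>y\<in>X. norm (y - x) = 1 \<and> f y \<le> ereal (a + p \<bullet> (y - x) + \<delta>)"
      by (meson linorder_linear)
    then have "\<forall>k. \<exists>y\<in>X. norm (y - x) = 1 \<and> f y \<le> ereal (a + p \<bullet> (y - x) + inverse (real (Suc k)))"
      by (simp del: of_nat_Suc)
    then obtain u where u: "\<And>k. u k \<in> X" "\<And>k. norm (u k - x) = 1"
        "\<And>k. f (u k) \<le> ereal (a + p \<bullet> (u k - x) + inverse (real (Suc k)))"
      by metis
    have "norm (u k) \<le> norm x + 1" for k
      using norm_triangle_ineq[of "u k - x" x] u(2)[of k] by simp
    then have "bounded (range u)" unfolding bounded_iff by blast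
    then obtain y r where r: "strict_mono (r :: nat \<Rightarrow> nat)" "(u \<circ> r) \<longlonglongrightarrow> y"
      using bounded_imp_convergent_subsequence by blast
    have yX: "y \<in> X" using closed _ r(2) by (rule closed_sequentially) (simp add: u)
    have "f y \<le> ereal (a + p \<bullet> (y - x) + 0)"
    proof (rule lsc_fun_on_limit_le[OF lsc yX _ r(2)])
      show "f ((u \<circ> r) k) \<le> ereal (a + p \<bullet> ((u \<circ> r) k - x) + inverse (real (Suc (r k))))" for k
        using u(3)[of "r k"] by (simp del: of_nat_Suc)
      have "(\<lambda>k. inverse (real (Suc (r k)))) \<longlonglongrightarrow> 0"
        using LIMSEQ_subseq_LIMSEQ[OF LIMSEQ_inverse_real_of_nat r(1)] by (simp add: o_def)
      then show "(\<lambda>k. a + p \<bullet> ((u \<circ> r) k - x) + inverse (real (Suc (r k))))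
          \<longlonglongrightarrow> a + p \<bullet> (y - x) + 0"
        by (intro tendsto_intros r(2))
    qed (simp add: u)
    then have fy: "f y = ereal (a + p \<bullet> (y - x))"
      using sub[OF yX] by (intro antisym) auto
    have "p \<in> subdifferential X f y"
    proof (rule subdifferentialI[OF pX fy])
      fix z assume "z \<in> X"
      then show "ereal (a + p \<bullet> (y - x) + p \<bullet> (z - y)) \<le> f z"
        using sub[of z] by (simp add: inner_diff_right)
    qed
    then have "y = x" using subdifferential_inj px yX by blast
    moreover have "(\<lambda>k. norm ((u \<circ> r) k - x)) \<longlonglongrightarrow> norm (y - x)"
      by (intro tendsto_intros r(2))
    then have "norm (y - x) = 1"
      using u(2) by (simp add: LIMSEQ_const_iff)
    ultimately show False by simp
  qed
  then obtain \<delta> where \<delta>: "\<delta> > 0"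
      "\<And>y. y \<in> X \<Longrightarrow> norm (y - x) = 1 \<Longrightarrow> ereal (a + p \<bullet> (y - x) + \<delta>) \<le> f y"
    by blast
  \<comment> \<open>Inside the unit ball the extra term is nonpositive and the subgradient
    inequality suffices. Outside, convexity on the segment from \<open>x\<close> to \<open>y\<close>
    carries over the gap at \<open>z\<close>, the radial projection of \<open>y\<close> onto the
    unit sphere.\<close>
  have growth: "a + p \<bullet> (y - x) + \<delta> * (norm (y - x) - 1) \<le> b" if y: "y \<in> X" "f y = ereal b" for y b
  proof (cases "norm (y - x) \<le> 1")
    case True
    then have "\<delta> * (norm (y - x) - 1) \<le> 0" using \<delta>(1) by (simp add: mult_le_0_iff)
    then show ?thesis using sub[OF y(1)] y(2) by simp
  next
    case False
    then have "y \<noteq> x" by auto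
    define t where "t = inverse (norm (y - x))"
    have t: "0 < t" "t < 1" "t * norm (y - x) = 1"
      using False \<open>y \<noteq> x\<close> by (auto simp: t_def inverse_less_1_iff)
    define z where "z = (1 - t) *\<^sub>R x + t *\<^sub>R y"
    have zx: "z - x = t *\<^sub>R (y - x)" by (simp add: z_def algebra_simps)
    have zX: "z \<in> X" using subspace y px by (simp add: z_def subspace_add subspace_scale)
    have "ereal (a + p \<bullet> (z - x) + \<delta>) \<le> f z"
      using t by (intro \<delta>(2)[OF zX]) (simp add: zx)
    also have "f z \<le> ereal ((1 - t) * a + t * b)"
      unfolding z_def using px y t a by (intro convexD) auto
    finally have "t * (p \<bullet> (y - x)) + \<delta> \<le> t * (b - a)"
      by (simp add: zx algebra_simps)
    moreover have "\<delta> = t * (\<delta> * norm (y - x))" using t by (simp add: mult.left_commute)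
    ultimately have "t * (p \<bullet> (y - x) + \<delta> * norm (y - x)) \<le> t * (b - a)"
      unfolding distrib_left by linarith
    then have "p \<bullet> (y - x) + \<delta> * norm (y - x) \<le> b - a" using t by simp
    then show ?thesis using \<delta>(1) by (simp add: right_diff_distrib)
  qed
  show ?thesis
  proof (rule int_edom_conjugateI[OF pX \<delta>(1)])
    fix y assume y: "y \<in> X"
    \<comment> \<open>The constant comes from recentring the growth estimate from \<open>x\<close>
      to the origin by the triangle inequality.\<close>
    show "ereal (p \<bullet> y + \<delta> * norm y - (\<delta> * norm x + \<delta> + p \<bullet> x - a)) \<le> f y"
    proof (cases "f y")
      case (real b)
      have "\<delta> * norm y \<le> \<delta> * (norm x + norm (y - x))"
        using \<delta>(1) norm_triangle_sub[of y x] by (intro mult_left_mono) auto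
      then show ?thesis
        using growth[OF y real] real by (simp add: inner_diff_right algebra_simps)
    qed (use not_minf[OF y] in auto)
  qed
qed

section \<open>Differentiability and essential smoothness of the conjugate\<close>

text \<open>Testing the inequality for \<open>q\<close> at a fixed point \<open>z\<close> bounds
  \<open>f x\<close> above, while linear growth at \<open>p\<close> bounds it below. Half of the
  growth rate absorbs \<open>q - p\<close>, the other half bounds \<open>x\<close>.\<close>

lemma subdifferential_locally_bounded:
  assumes "p \<in> int_edom X (conjugate X f)"
  obtains \<delta> K where "\<delta> > 0"
    "\<And>q x. x \<in> X \<Longrightarrow> q \<in> subdifferential X f x \<Longrightarrow> dist q p < \<delta> \<Longrightarrow> norm x \<le> K"
proof -
  obtain \<rho> M where \<rho>: "\<rho> > 0" "\<And>x. x \<in> X \<Longrightarrow> ereal (p \<bullet> x + \<rho> * norm x - M) \<le> f x"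
    using int_edom_conjugateE[OF assms] by metis
  obtain z v where z: "z \<in> X" "f z = ereal v" using finite_point .
  \<comment> \<open>A bound for \<open>- (q \<bullet> z)\<close> valid for all slopes
    \<open>q\<close> in the ball considered.\<close>
  define L where "L = (norm p + \<rho>) * norm z"
  show thesis
  proof (rule that)
    show "\<rho> / 2 > 0" using \<rho> by simp
    fix q x assume x: "x \<in> X" and q: "q \<in> subdifferential X f x" and qp: "dist q p < \<rho> / 2"
    obtain a where a: "f x = ereal a" "\<And>y. y \<in> X \<Longrightarrow> ereal (a + q \<bullet> (y - x)) \<le> f y"
      using subdifferentialE[OF q x] by metis
    have "p \<bullet> x + \<rho> * norm x - M \<le> v - q \<bullet> (z - x)"
      using \<rho>(2)[OF x] a(2)[OF z(1)] a(1) z(2) by simp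
    then have 1: "\<rho> * norm x \<le> M + v + (q - p) \<bullet> x - q \<bullet> z"
      by (simp add: inner_diff_right inner_diff_left)
    have "(q - p) \<bullet> x \<le> norm (q - p) * norm x" by (rule norm_cauchy_schwarz)
    also have "\<dots> \<le> (\<rho> / 2) * norm x"
      using qp by (intro mult_right_mono) (auto simp: dist_norm)
    finally have 2: "(q - p) \<bullet> x \<le> (\<rho> / 2) * norm x" .
    have nq: "norm q \<le> norm p + \<rho>"
      using qp \<rho>(1) norm_triangle_sub[of q p] by (simp add: dist_norm)
    have "- (q \<bullet> z) \<le> norm q * norm z"
      using norm_cauchy_schwarz[of "-q" z] by simp
    also have "\<dots> \<le> L" unfolding L_def using nq by (intro mult_right_mono) auto
    finally have "(\<rho> / 2) * norm x \<le> M + v + L" using 1 2 by linarith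
    then show "norm x \<le> 2 * (M + v + L) / \<rho>" using \<rho>(1) by (simp add: field_simps)
  qed
qed

text \<open>A violating sequence is bounded by the previous lemma, and by the closed graph it
  accumulates at a point having \<open>p\<close> as subgradient. That point is \<open>x\<close>,
  although the sequence keeps distance \<open>e\<close> from it.\<close>

lemma subdifferential_continuous:
  assumes p: "p \<in> int_edom X (conjugate X f)" and x: "x \<in> X" "p \<in> subdifferential X f x"
    and e: "e > 0"
  obtains d where "d > 0"
    "\<And>q y. y \<in> X \<Longrightarrow> q \<in> subdifferential X f y \<Longrightarrow> dist q p < d \<Longrightarrow> dist y x < e"
proof (rule ccontr)
  assume "\<not> thesis"
  then have no: "\<And>d. d > 0 \<Longrightarrow> \<exists>y q. y \<in> X \<and> q \<in> subdifferential X f y \<and> dist q p < d \<and> e \<le> dist y x"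
    using that by (meson not_le)
  obtain \<delta> K where \<delta>: "\<delta> > 0"
    "\<And>q x. x \<in> X \<Longrightarrow> q \<in> subdifferential X f x \<Longrightarrow> dist q p < \<delta> \<Longrightarrow> norm x \<le> K"
    using subdifferential_locally_bounded[OF p] by metis
  have "\<forall>k. \<exists>y q. y \<in> X \<and> q \<in> subdifferential X f y \<and> dist q p < min \<delta> (inverse (real (Suc k))) \<and> e \<le> dist y x"
    by (intro allI no) (use \<delta>(1) in simp)
  then obtain u P where u: "\<And>k. u k \<in> X" "\<And>k. P k \<in> subdifferential X f (u k)"
    "\<And>k. dist (P k) p < min \<delta> (inverse (real (Suc k)))" "\<And>k. e \<le> dist (u k) x"
    by metis
  have "norm (u k) \<le> K" for k using \<delta>(2)[OF u(1,2)] u(3)[of k] by simp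
  then have "bounded (range u)" unfolding bounded_iff by blast
  then obtain l r where r: "strict_mono (r :: nat \<Rightarrow> nat)" "(u \<circ> r) \<longlonglongrightarrow> l"
    using bounded_imp_convergent_subsequence by blast
  have "P \<longlonglongrightarrow> p"
  proof (rule Lim_null_comparison[THEN LIM_zero_cancel])
    show "\<forall>\<^sub>F k in sequentially. norm (P k - p) \<le> inverse (real (Suc k))"
      using u(3) by (auto simp: dist_norm less_imp_le simp del: of_nat_Suc)
    show "(\<lambda>k. inverse (real (Suc k))) \<longlonglongrightarrow> 0" by (rule LIMSEQ_inverse_real_of_nat)
  qed
  then have "(P \<circ> r) \<longlonglongrightarrow> p" using r(1) by (rule LIMSEQ_subseq_LIMSEQ)
  then have l: "l \<in> X" "p \<in> subdifferential X f l"
    using subdifferential_closed_graph[of "P \<circ> r" "u \<circ> r"] u(1,2) r(2) by auto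
  then have "l = x" using subdifferential_inj x by blast
  moreover have "(\<lambda>k. dist ((u \<circ> r) k) x) \<longlonglongrightarrow> dist l x"
    by (intro tendsto_intros r(2))
  then have "e \<le> dist l x" by (rule LIMSEQ_le_const) (use u(4) in auto)
  ultimately show False using e by simp
qed

text \<open>If \<open>q\<close> is a subgradient of \<open>f\<close> at \<open>y\<close>, the
  supporting inequalities of the conjugate at \<open>p\<close> and at \<open>q\<close> squeeze the
  remainder between 0 and \<open>(y - x) \<bullet> (q - p)\<close>. Continuity of \<open>y\<close>
  in \<open>q\<close> makes this \<open>o(norm (q - p))\<close>.\<close>

lemma conjugate_has_gradient:
  assumes p: "p \<in> int_edom X (conjugate X f)" and x: "x \<in> X" "p \<in> subdifferential X f x"
  shows "has_gradient_on X (conjugate X f) p x"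
proof -
  define F where "F = (\<lambda>q. real_of_ereal (conjugate X f q))"
  have F: "conjugate X f q = ereal (F q)" if q: "q \<in> subdifferential X f y" "y \<in> X" for q y
  proof -
    obtain b where "f y = ereal b" using subdifferentialE[OF q] by metis
    then show ?thesis using conjugate_eq[OF q] by (simp add: F_def)
  qed
  have sub: "F q + y \<bullet> (q' - q) \<le> F q'"
    if "q \<in> subdifferential X f y" "y \<in> X" "q' \<in> subdifferential X f y'" "y' \<in> X" for q y q' y'
  proof -
    have "q' \<in> X" using that(3) by (auto simp: subdifferential_def)
    then have "conjugate X f q + ereal (y \<bullet> (q' - q)) \<le> conjugate X f q'"
      using subdifferential_conjugateI[OF that(1,2)] by (auto simp: subdifferential_def)
    then show ?thesis using F that by simp
  qed
  have "openin (top_of_set X) (int_edom X (conjugate X f))"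
    unfolding int_edom_def by (rule openin_interior_of)
  \<comment> \<open>Within this radius every \<open>q\<close> is itself interior, which guarantees
    the point \<open>y\<close>.\<close>
  then obtain r where r: "r > 0" "\<And>q. q \<in> X \<Longrightarrow> dist q p < r \<Longrightarrow> q \<in> int_edom X (conjugate X f)"
    using p unfolding openin_euclidean_subtopology_iff by blast
  have "(F has_derivative (\<lambda>h. x \<bullet> h)) (at p within X)"
    unfolding has_derivative_within_alt
  proof (intro conjI allI impI)
    show "bounded_linear (\<lambda>h. x \<bullet> h)" by (rule bounded_linear_inner_right)
    fix e :: real assume "e > 0"
    then obtain d where d: "d > 0"
      "\<And>q y. y \<in> X \<Longrightarrow> q \<in> subdifferential X f y \<Longrightarrow> dist q p < d \<Longrightarrow> dist y x < e"
      using subdifferential_continuous[OF p x] by metis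
    show "\<exists>d>0. \<forall>q\<in>X. norm (q - p) < d \<longrightarrow> norm (F q - F p - x \<bullet> (q - p)) \<le> e * norm (q - p)"
    proof (intro exI[of _ "min d r"] conjI ballI impI)
      fix q assume q: "q \<in> X" "norm (q - p) < min d r"
      then have "q \<in> int_edom X (conjugate X f)" using r(2) by (simp add: dist_norm)
      then obtain y where y: "y \<in> X" "q \<in> subdifferential X f y"
        by (rule subdifferential_exists)
      have "F p + x \<bullet> (q - p) \<le> F q" "F q + y \<bullet> (p - q) \<le> F p"
        using sub x y by blast+
      then have 1: "0 \<le> F q - F p - x \<bullet> (q - p)" "F q - F p - x \<bullet> (q - p) \<le> (y - x) \<bullet> (q - p)"
        by (auto simp: inner_diff_right inner_diff_left)
      have "(y - x) \<bullet> (q - p) \<le> norm (y - x) * norm (q - p)" by (rule norm_cauchy_schwarz)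
      also have "\<dots> \<le> e * norm (q - p)"
        using d(2)[OF y] q(2) by (intro mult_right_mono) (auto simp: dist_norm)
      finally show "norm (F q - F p - x \<bullet> (q - p)) \<le> e * norm (q - p)" using 1 by simp
    qed (use d r in auto)
  qed
  then show ?thesis using x by (simp add: has_gradient_on_def F_def)
qed

text \<open>Translates gradients of the conjugate back into points of \<open>f\<close>, where the
  closed graph applies.\<close>

lemma conjugate_gradient_subdifferential:
  assumes p: "p \<in> int_edom X (conjugate X f)" and g: "has_gradient_on X (conjugate X f) p g"
  shows "p \<in> subdifferential X f g"
proof -
  obtain x where x: "x \<in> X" "p \<in> subdifferential X f x"
    using p by (rule subdifferential_exists)
  have "x = g"
    using subspace g subdifferential_conjugateI[OF x(2,1)] p conjugate_not_minf
    by (rule has_gradient_on_unique)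
  then show ?thesis using x by simp
qed

lemma conjugate_essentially_smooth:
  assumes ne: "int_edom X (conjugate X f) \<noteq> {}"
  shows "essentially_smooth_on X (conjugate X f)"
  unfolding essentially_smooth_on_def
proof (intro conjI ballI allI impI)
  fix p assume "p \<in> int_edom X (conjugate X f)"
  then show "\<exists>g. has_gradient_on X (conjugate X f) p g"
    using subdifferential_exists conjugate_has_gradient by metis
next
  fix u :: "nat \<Rightarrow> 'a" and g b
  assume "(\<forall>k. u k \<in> int_edom X (conjugate X f) \<and> has_gradient_on X (conjugate X f) (u k) (g k)) \<and>
        u \<longlonglongrightarrow> b \<and> b \<in> top_of_set X frontier_of int_edom X (conjugate X f)"
  then have u: "\<And>k. u k \<in> int_edom X (conjugate X f)" "\<And>k. has_gradient_on X (conjugate X f) (u k) (g k)"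
    and lim: "u \<longlonglongrightarrow> b" and b: "b \<in> top_of_set X frontier_of int_edom X (conjugate X f)"
    by auto
  \<comment> \<open>The interior is open, hence disjoint from its frontier.\<close>
  have bn: "b \<notin> int_edom X (conjugate X f)"
    using b by (simp add: frontier_of_def int_edom_def)
  have gX: "g k \<in> X" for k using u(2) by (auto simp: has_gradient_on_def)
  have sub: "u k \<in> subdifferential X f (g k)" for k
    using conjugate_gradient_subdifferential u by blast
  show "filterlim (\<lambda>k. norm (g k)) at_top sequentially"
  proof (rule ccontr)
    assume "\<not> ?thesis"
    then obtain K where K: "\<not> (\<forall>\<^sub>F k in sequentially. K \<le> norm (g k))"
      unfolding filterlim_at_top by blast
    then have "\<exists>\<^sub>F k in sequentially. norm (g k) < K"
      by (simp add: frequently_def not_less)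
    then obtain r where r: "strict_mono (r :: nat \<Rightarrow> nat)" "\<And>k. norm (g (r k)) < K"
      using infinite_enumerate[of "{k. norm (g k) < K}"]
      by (auto simp: frequently_cofinite simp flip: cofinite_eq_sequentially)
    then have "bounded (range (g \<circ> r))"
      unfolding bounded_iff by (auto intro!: exI[of _ K] less_imp_le)
    then obtain l s where s: "strict_mono (s :: nat \<Rightarrow> nat)" "((g \<circ> r) \<circ> s) \<longlonglongrightarrow> l"
      using bounded_imp_convergent_subsequence by blast
    have "((u \<circ> r) \<circ> s) \<longlonglongrightarrow> b"
      using lim r(1) s(1) by (intro LIMSEQ_subseq_LIMSEQ)
    then have "l \<in> X" "b \<in> subdifferential X f l"
      using subdifferential_closed_graph[of "(u \<circ> r) \<circ> s" "(g \<circ> r) \<circ> s"] sub gX s(2) by auto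
    then show False using bn subdifferential_imp_int_edom_conjugate by blast
  qed
qed (rule ne)

section \<open>Essential strict convexity of the conjugate\<close>

text \<open>A subgradient \<open>x\<close> of the conjugate at \<open>r\<close> bounds the gradients at the interior points
  \<open>t *\<^sub>R r\<close>, \<open>t < 1\<close>, so these accumulate as \<open>t\<close> tends to 1, and no biconjugation is needed.\<close>
lemma subdifferential_conjugate_imp_int_edom:
  assumes zero: "0 \<in> int_edom X (conjugate X f)" and rX: "r \<in> X"
    and x: "x \<in> subdifferential X (conjugate X f) r"
  shows "r \<in> int_edom X (conjugate X f)"
proof -
  \<comment> \<open>Growth at slope 0 turns the upper bound on \<open>f (u k)\<close> obtained below
    into a bound on \<open>u k\<close>.\<close>
  obtain \<rho> M where \<rho>: "\<rho> > 0" "\<And>y. y \<in> X \<Longrightarrow> ereal (\<rho> * norm y - M) \<le> f y"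
    using int_edom_conjugateE[OF zero] by (metis inner_zero_left add_0)
  have sub: "conjugate X f r + ereal (x \<bullet> (q - r)) \<le> conjugate X f q" if "q \<in> X" for q
    using x that by (auto simp: subdifferential_def)
  have "conjugate X f 0 < \<infinity>" "0 \<in> X" using zero unfolding int_edom_iff by auto
  then obtain c where c: "conjugate X f r = ereal c"
    using sub[of 0] conjugate_not_minf[of r] by (cases "conjugate X f r") auto
  define s where "s k = inverse (real (Suc k))" for k
  have s: "0 < s k" "s k \<le> 1" for k by (auto simp: s_def inverse_le_1_iff)
  define P where "P k = (1 - s k) *\<^sub>R r" for k
  have PX: "P k \<in> X" for k using subspace rX by (simp add: P_def subspace_scale)
  \<comment> \<open>The minorant of slope \<open>r\<close> and the linearly growing one of slope 0,
    weighted by \<open>1 - s k\<close> and \<open>s k\<close>, combine to one of slope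
    \<open>P k\<close> that still grows at rate \<open>s k * \<rho>\<close>.\<close>
  have int: "P k \<in> int_edom X (conjugate X f)" for k
  proof (rule int_edom_conjugateI[OF PX])
    show "s k * \<rho> > 0" using s \<rho> by simp
    fix y assume y: "y \<in> X"
    show "ereal (P k \<bullet> y + s k * \<rho> * norm y - ((1 - s k) * c + s k * M)) \<le> f y"
    proof (cases "f y")
      case (real b)
      have "r \<bullet> y - c \<le> b" using c conjugate_le_iff[OF proper, of r c] y real by auto
      moreover have "\<rho> * norm y - M \<le> b" using \<rho>(2)[OF y] real by simp
      ultimately have "(1 - s k) * (r \<bullet> y - c) + s k * (\<rho> * norm y - M) \<le> (1 - s k) * b + s k * b"
        using s[of k] by (intro add_mono mult_left_mono) auto
      then show ?thesis using real by (simp add: P_def algebra_simps)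
    qed (use not_minf[OF y] in auto)
  qed
  have "\<exists>y\<in>X. P k \<in> subdifferential X f y" for k
    using subdifferential_exists[OF int] by blast
  then obtain u where u: "\<And>k. u k \<in> X" "\<And>k. P k \<in> subdifferential X f (u k)"
    by metis
  have "norm (u k) \<le> (M + r \<bullet> x - c) / \<rho>" for k
  proof -
    obtain a where a: "f (u k) = ereal a" using subdifferentialE[OF u(2,1)] by metis
    have conj: "conjugate X f (P k) = ereal (P k \<bullet> u k - a)"
      using conjugate_eq[OF u(2,1) a] .
    have 1: "c + x \<bullet> (P k - r) \<le> P k \<bullet> u k - a"
      using sub[OF PX, of k] c conj by simp
    have "conjugate X f (P k) + ereal (u k \<bullet> (r - P k)) \<le> conjugate X f r"
      using subdifferential_conjugateI[OF u(2,1)] rX by (auto simp: subdifferential_def)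
    then have 2: "P k \<bullet> u k - a + u k \<bullet> (r - P k) \<le> c" using c conj by simp
    have "r - P k = s k *\<^sub>R r" "P k - r = - (s k *\<^sub>R r)" by (auto simp: P_def algebra_simps)
    \<comment> \<open>Monotonicity of the subdifferential of the conjugate between
      \<open>P k\<close> and \<open>r\<close>: adding the two inequalities cancels its
      values.\<close>
    then have "s k * (r \<bullet> u k) \<le> s k * (r \<bullet> x)"
      using 1 2 by (simp add: inner_commute)
    then have "r \<bullet> u k \<le> r \<bullet> x" using s(1)[of k] by simp
    then have "(1 - s k) * (r \<bullet> u k) \<le> (1 - s k) * (r \<bullet> x)"
      using s(2)[of k] by (intro mult_left_mono) auto
    then have "a \<le> r \<bullet> x - c"
      using 1 \<open>P k - r = _\<close> by (simp add: P_def inner_commute algebra_simps)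
    then have "\<rho> * norm (u k) \<le> M + r \<bullet> x - c" using \<rho>(2)[OF u(1), of k] a by simp
    then show ?thesis using \<rho>(1) by (simp add: field_simps)
  qed
  then have "bounded (range u)" unfolding bounded_iff by blast
  then obtain l n where n: "strict_mono (n :: nat \<Rightarrow> nat)" "(u \<circ> n) \<longlonglongrightarrow> l"
    using bounded_imp_convergent_subsequence by blast
  have "P \<longlonglongrightarrow> (1 - 0) *\<^sub>R r"
    unfolding P_def s_def by (intro tendsto_intros LIMSEQ_inverse_real_of_nat)
  then have "(P \<circ> n) \<longlonglongrightarrow> r" using LIMSEQ_subseq_LIMSEQ n(1) by force
  then have "l \<in> X" "r \<in> subdifferential X f l"
    using subdifferential_closed_graph[of "P \<circ> n" "u \<circ> n"] u n(2) by auto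
  then show ?thesis using subdifferential_imp_int_edom_conjugate by blast
qed

text \<open>Let \<open>x\<close> have the intermediate slope \<open>r\<close> as subgradient.
  Equality in the convexity inequality would make the Fenchel-Young inequality tight at
  \<open>x\<close> for both \<open>p\<close> and \<open>q\<close>, so both would be subgradients of
  \<open>f\<close> at \<open>x\<close> and equal its gradient.\<close>

lemma conjugate_essentially_strictly_convex:
  assumes zero: "0 \<in> int_edom X (conjugate X f)"
    and dom_open: "openin (top_of_set X) (edom X f)"
    and grad: "\<And>x. x \<in> int_edom X f \<Longrightarrow> \<exists>g. has_gradient_on X f x g"
  shows "essentially_strictly_convex_on X (conjugate X f)"
  unfolding essentially_strictly_convex_on_def strictly_convex_fun_on_def
proof (intro allI impI ballI)
  fix S p q and t :: real
  assume S: "convex S \<and> S \<subseteq> {p \<in> X. subdifferential X (conjugate X f) p \<noteq> {}}"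
    and pq: "p \<in> S" "q \<in> S" and t: "p \<noteq> q \<and> 0 < t \<and> t < 1"
  have int: "p \<in> int_edom X (conjugate X f)" if "p \<in> S" for p
    using S that subdifferential_conjugate_imp_int_edom[OF zero] by blast
  have fin: "\<exists>c. conjugate X f p = ereal c" if "p \<in> S" for p
    using int[OF that] conjugate_not_minf[of p] unfolding int_edom_iff
    by (cases "conjugate X f p") auto
  define r where "r = (1 - t) *\<^sub>R p + t *\<^sub>R q"
  have "r \<in> S" using S pq t unfolding r_def by (intro convexD_alt) auto
  then obtain x where x: "x \<in> X" "r \<in> subdifferential X f x"
    using subdifferential_exists int by metis
  obtain a where a: "f x = ereal a" using subdifferentialE[OF x(2,1)] by metis
  obtain c where c: "conjugate X f p = ereal c" using fin pq by blast
  obtain d where d: "conjugate X f q = ereal d" using fin pq by blast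
  have le: "p \<bullet> x - a \<le> c" "q \<bullet> x - a \<le> d"
    using conjugate_upper[OF x(1), of p f] conjugate_upper[OF x(1), of q f] a c d by auto
  \<comment> \<open>Openness of the domain puts \<open>x\<close> where \<open>f\<close> is
    differentiable.\<close>
  have "x \<in> int_edom X f"
    using dom_open x(1) a by (simp add: int_edom_def interior_of_openin edom_def)
  then obtain g where g: "has_gradient_on X f x g" "x \<in> int_edom X f" using grad by blast
  have unique: "p' = g" if p': "p' \<in> S" "conjugate X f p' = ereal (p' \<bullet> x - a)" for p'
  proof (rule has_gradient_on_unique[OF subspace g(1) _ g(2) not_minf])
    show "p' \<in> subdifferential X f x"
    proof (rule subdifferentialI[OF _ a])
      show "p' \<in> X" using S p' by blast
      fix y assume "y \<in> X"
      then show "ereal (a + p' \<bullet> (y - x)) \<le> f y"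
        using conjugate_le_iff[OF proper, of p' "p' \<bullet> x - a"] p'(2)
        by (simp add: inner_diff_right algebra_simps)
    qed
  qed
  have "c \<noteq> p \<bullet> x - a \<or> d \<noteq> q \<bullet> x - a"
    using unique[OF pq(1)] unique[OF pq(2)] c d t by auto
  then have "p \<bullet> x - a < c \<or> q \<bullet> x - a < d" using le by auto
  then have "(1 - t) * (p \<bullet> x - a) + t * (q \<bullet> x - a) < (1 - t) * c + t * d"
  proof
    assume "p \<bullet> x - a < c"
    then show ?thesis using le t by (intro add_less_le_mono mult_strict_left_mono mult_left_mono) auto
  next
    assume "q \<bullet> x - a < d"
    then show ?thesis using le t by (intro add_le_less_mono mult_strict_left_mono mult_left_mono) auto
  qed
  then have "r \<bullet> x - a < (1 - t) * c + t * d"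
    by (simp add: r_def inner_add_left algebra_simps)
  then show "conjugate X f ((1 - t) *\<^sub>R p + t *\<^sub>R q)
      < ereal (1 - t) * conjugate X f p + ereal t * conjugate X f q"
    using conjugate_eq[OF x(2,1) a] c d by (simp add: r_def)
qed

end

section \<open>Componentwise formulas on the whole space\<close>

locale partially_trivial_fun =
  fixes \<Phi> \<phi> :: "'a::euclidean_space \<Rightarrow> ereal" and X1 X2 X3 :: "'a set"
  assumes decomp: "orthogonal_decomposition X1 X2 X3"
    and structural: "\<And>x1 x2 x3. \<lbrakk>x1 \<in> X1; x2 \<in> X2; x3 \<in> X3\<rbrakk> \<Longrightarrow>
           \<Phi> (x1 + x2 + x3) = (if x3 = 0 then \<phi> x1 else \<infinity>)"
    and proper: "proper_fun_on X1 \<phi>"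
begin

lemma subspaces: "subspace X1" "subspace X2" "subspace X3"
  using decomp by (auto simp: orthogonal_decomposition_def)

lemma zero_mem [simp]: "0 \<in> X1" "0 \<in> X2" "0 \<in> X3"
  using subspaces by (auto simp: subspace_0)

lemma decomposeE:
  obtains x1 x2 x3 where "x1 \<in> X1" "x2 \<in> X2" "x3 \<in> X3" "x = x1 + x2 + x3"
proof -
  have "x \<in> X1 + X2 + X3" using decomp by (simp add: orthogonal_decomposition_def)
  then show thesis by (auto elim!: set_plus_elim intro: that)
qed

lemma inner_components:
  assumes "x1 \<in> X1" "x2 \<in> X2" "x3 \<in> X3" "y1 \<in> X1" "y2 \<in> X2" "y3 \<in> X3"
  shows "(x1 + x2 + x3) \<bullet> (y1 + y2 + y3) = x1 \<bullet> y1 + x2 \<bullet> y2 + x3 \<bullet> y3"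
proof -
  have "u \<bullet> v = 0" "v \<bullet> u = 0" if "u \<in> X1 \<and> v \<in> X2 \<or> u \<in> X1 \<and> v \<in> X3 \<or> u \<in> X2 \<and> v \<in> X3" for u v
    using decomp that by (auto simp: orthogonal_decomposition_def orthogonal_def inner_commute)
  then show ?thesis using assms by (simp add: inner_add_left inner_add_right)
qed

lemma finite_point:
  obtains z v where "z \<in> X1" "\<phi> z = ereal v"
proof -
  obtain z where "z \<in> X1" "\<phi> z < \<infinity>" "\<phi> z \<noteq> -\<infinity>" using proper by (auto simp: proper_fun_on_def)
  then show thesis using that by (cases "\<phi> z") auto
qed

text \<open>The function is constant along \<open>X2\<close>, which forces that component of a
  subgradient to vanish. It is infinite off \<open>x3 = 0\<close>, which leaves the
  \<open>X3\<close> component free.\<close>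

lemma subdifferential_eq:
  assumes x: "x1 \<in> X1" "x2 \<in> X2" "x3 \<in> X3"
  shows "subdifferential UNIV \<Phi> (x1 + x2 + x3) =
    (if x3 = 0 then subdifferential X1 \<phi> x1 + {0} + X3 else {})"
proof -
  obtain z v where z: "z \<in> X1" "\<phi> z = ereal v" using finite_point .
  have "\<phi> x1 \<noteq> -\<infinity>" using proper x by (auto simp: proper_fun_on_def)
  have fin: "x3 = 0 \<and> (\<exists>a. \<phi> x1 = ereal a)" if p: "p \<in> subdifferential UNIV \<Phi> (x1 + x2 + x3)" for p
  proof -
    have "\<Phi> (x1 + x2 + x3) + ereal (p \<bullet> (z - (x1 + x2 + x3))) \<le> \<Phi> z"
      using p by (auto simp: subdifferential_def)
    moreover have "\<Phi> z = ereal v" using structural[of z 0 0] z by simp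
    ultimately show ?thesis
      using structural[OF x] \<open>\<phi> x1 \<noteq> -\<infinity>\<close> by (cases "\<phi> x1") (auto split: if_splits)
  qed
  show ?thesis
  proof (cases "x3 = 0")
    case False
    then show ?thesis using fin by auto
  next
    case True
    have "p \<in> subdifferential UNIV \<Phi> (x1 + x2 + x3) \<longleftrightarrow> p \<in> subdifferential X1 \<phi> x1 + {0} + X3" for p
    proof
      assume p: "p \<in> subdifferential UNIV \<Phi> (x1 + x2 + x3)"
      obtain a where a: "\<phi> x1 = ereal a" using fin[OF p] by blast
      obtain p1 p2 p3 where p123: "p1 \<in> X1" "p2 \<in> X2" "p3 \<in> X3" "p = p1 + p2 + p3"
        by (rule decomposeE)
      have le: "\<phi> x1 + ereal (p1 \<bullet> (y1 - x1) + p2 \<bullet> y2) \<le> \<phi> y1" if "y1 \<in> X1" "y2 \<in> X2" for y1 y2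
      proof -
        \<comment> \<open>The test point is displaced from \<open>x2\<close> by \<open>y2\<close>,
          so that the inequality involves \<open>y2\<close> alone in the second component.\<close>
        have "\<Phi> (x1 + x2 + x3) + ereal (p \<bullet> ((y1 + (x2 + y2) + 0) - (x1 + x2 + x3)))
            \<le> \<Phi> (y1 + (x2 + y2) + 0)"
          using p unfolding subdifferential_def by blast
        moreover have "(y1 + (x2 + y2) + 0) - (x1 + x2 + x3) = (y1 - x1) + y2 + 0"
          using True by simp
        moreover have "p \<bullet> ((y1 - x1) + y2 + 0) = p1 \<bullet> (y1 - x1) + p2 \<bullet> y2"
          using inner_components[OF p123(1-3), of "y1 - x1" y2 0] that x subspaces p123
          by (simp add: subspace_diff)
        moreover have "\<Phi> (x1 + x2 + x3) = \<phi> x1" "\<Phi> (y1 + (x2 + y2) + 0) = \<phi> y1"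
          using structural[OF x] structural[of y1 "x2 + y2" 0] True that x subspaces
          by (auto simp: subspace_add)
        ultimately show ?thesis by (simp only:)
      qed
      \<comment> \<open>The displacement \<open>p2\<close> itself is the test direction.\<close>
      have "p2 \<bullet> p2 \<le> 0" using le[of x1 p2] x p123 a by simp
      then have "p2 = 0" by (metis antisym inner_eq_zero_iff inner_ge_zero)
      moreover have "p1 \<in> subdifferential X1 \<phi> x1"
        using le[of _ 0] p123 by (simp add: subdifferential_def)
      ultimately show "p \<in> subdifferential X1 \<phi> x1 + {0} + X3"
        using p123 by (auto intro!: set_plus_intro)
    next
      assume "p \<in> subdifferential X1 \<phi> x1 + {0} + X3"
      then obtain p1 p3 where p: "p1 \<in> subdifferential X1 \<phi> x1" "p3 \<in> X3" "p = p1 + 0 + p3"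
        by (auto elim!: set_plus_elim)
      have p1: "p1 \<in> X1" using p by (auto simp: subdifferential_def)
      have "\<Phi> (x1 + x2 + x3) + ereal (p \<bullet> (y - (x1 + x2 + x3))) \<le> \<Phi> y" for y
      proof -
        obtain y1 y2 y3 where y: "y1 \<in> X1" "y2 \<in> X2" "y3 \<in> X3" "y = y1 + y2 + y3"
          by (rule decomposeE)
        show ?thesis
        proof (cases "y3 = 0")
          case y3: True
          have diff: "y - (x1 + x2 + x3) = (y1 - x1) + (y2 - x2) + 0" using True y3 y by simp
          have "p \<bullet> (y - (x1 + x2 + x3)) = p1 \<bullet> (y1 - x1)"
            unfolding diff using inner_components[OF p1 zero_mem(2) p(2), of "y1 - x1" "y2 - x2" 0] p(3) x y(1-3) subspaces
            by (simp add: subspace_diff)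
          moreover have "\<phi> x1 + ereal (p1 \<bullet> (y1 - x1)) \<le> \<phi> y1"
            using p(1) y by (auto simp: subdifferential_def)
          ultimately show ?thesis using structural[OF x] structural[OF y(1-3)] y(4) True y3 by simp
        qed (use structural[OF y(1-3)] y(4) in auto)
      qed
      then show "p \<in> subdifferential UNIV \<Phi> (x1 + x2 + x3)" by (simp add: subdifferential_def)
    qed
    then show ?thesis using True by auto
  qed
qed

text \<open>Points with \<open>x3\<close> nonzero contribute \<open>-\<infinity>\<close> to the
  supremum, so \<open>p3\<close> is invisible. A nonzero \<open>p2\<close> makes the supremum
  unbounded along the ray through \<open>p2\<close>.\<close>

lemma conjugate_eq:
  assumes p: "p1 \<in> X1" "p2 \<in> X2" "p3 \<in> X3"
  shows "conjugate UNIV \<Phi> (p1 + p2 + p3) = (if p2 = 0 then conjugate X1 \<phi> p1 else \<infinity>)"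
proof -
  have ge: "ereal (p1 \<bullet> x1 + p2 \<bullet> x2) - \<phi> x1 \<le> conjugate UNIV \<Phi> (p1 + p2 + p3)"
    if "x1 \<in> X1" "x2 \<in> X2" for x1 x2
    using conjugate_upper[of "x1 + x2 + 0" UNIV "p1 + p2 + p3" \<Phi>]
      inner_components[OF p that zero_mem(3)] structural[OF that zero_mem(3)] by simp
  show ?thesis
  proof (cases "p2 = 0")
    case True
    have "conjugate UNIV \<Phi> (p1 + p2 + p3) \<le> conjugate X1 \<phi> p1"
      unfolding conjugate_def[of UNIV]
    proof (rule SUP_least)
      fix x
      obtain x1 x2 x3 where x: "x1 \<in> X1" "x2 \<in> X2" "x3 \<in> X3" "x = x1 + x2 + x3"
        by (rule decomposeE)
      show "ereal ((p1 + p2 + p3) \<bullet> x) - \<Phi> x \<le> conjugate X1 \<phi> p1"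
        using structural[OF x(1-3)] inner_components[OF p x(1-3)] conjugate_upper[OF x(1), of p1 \<phi>] x(4) True
        by (cases "x3 = 0") auto
    qed
    moreover have "conjugate X1 \<phi> p1 \<le> conjugate UNIV \<Phi> (p1 + p2 + p3)"
      unfolding conjugate_def[of X1] using ge[of _ 0] by (intro SUP_least) simp
    ultimately show ?thesis using True by simp
  next
    case False
    obtain z v where z: "z \<in> X1" "\<phi> z = ereal v" using finite_point .
    have "ereal B \<le> conjugate UNIV \<Phi> (p1 + p2 + p3)" for B
    proof -
      \<comment> \<open>Chosen so that the term at \<open>z + s *\<^sub>R p2\<close> equals
        \<open>B\<close> exactly.\<close>
      define s where "s = (B + v - p1 \<bullet> z) / (p2 \<bullet> p2)"
      have "s * (p2 \<bullet> p2) = B + v - p1 \<bullet> z" using False by (simp add: s_def)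
      then show ?thesis
        using ge[of z "s *\<^sub>R p2"] z p subspaces by (simp add: subspace_scale)
    qed
    then have "conjugate UNIV \<Phi> (p1 + p2 + p3) = \<infinity>" by (intro ereal_top)
    then show ?thesis using False by simp
  qed
qed

text \<open>The domain lies in the orthogonal complement \<open>W\<close> of \<open>X2\<close> and
  contains a ball of \<open>W\<close> around 0; its affine hull stays inside
  \<open>W\<close>.\<close>

lemma zero_rel_interior_edom_conjugate:
  assumes "0 \<in> int_edom X1 (conjugate X1 \<phi>)"
  shows "0 \<in> rel_interior (edom UNIV (conjugate UNIV \<Phi>))"
proof -
  define D where "D = edom UNIV (conjugate UNIV \<Phi>)"
  define W where "W = {p. \<forall>x\<in>X2. orthogonal x p}"
  obtain r where r: "r > 0" "\<And>q. q \<in> X1 \<Longrightarrow> dist q 0 < r \<Longrightarrow> conjugate X1 \<phi> q < \<infinity>"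
    using assms unfolding int_edom_iff by blast
  have "D \<subseteq> W"
  proof
    fix p assume "p \<in> D"
    obtain p1 p2 p3 where p: "p1 \<in> X1" "p2 \<in> X2" "p3 \<in> X3" "p = p1 + p2 + p3"
      by (rule decomposeE)
    have "p2 = 0" using \<open>p \<in> D\<close> conjugate_eq[OF p(1-3)] p(4) by (auto simp: D_def edom_def split: if_splits)
    then show "p \<in> W"
      using inner_components[OF zero_mem(1) _ zero_mem(3) p(1-3)] p(4) by (auto simp: W_def orthogonal_def)
  qed
  moreover have "affine W"
    unfolding W_def
    by (intro subspace_imp_affine) (auto simp: subspace_def orthogonal_def inner_add_right)
  ultimately have hull: "affine hull D \<subseteq> W" by (rule hull_minimal)
  have ball: "ball 0 r \<inter> W \<subseteq> D"
  proof
    fix p assume pr: "p \<in> ball 0 r \<inter> W"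
    obtain p1 p2 p3 where p: "p1 \<in> X1" "p2 \<in> X2" "p3 \<in> X3" "p = p1 + p2 + p3"
      by (rule decomposeE)
    \<comment> \<open>Membership in \<open>W\<close> is tested against the component
      \<open>p2\<close> of \<open>p\<close> itself.\<close>
    have "p2 \<bullet> p2 = 0"
      using inner_components[OF zero_mem(1) p(2) zero_mem(3) p(1-3)] p pr
      by (auto simp: W_def orthogonal_def)
    then have p2: "p2 = 0" by simp
    have "p1 \<bullet> p1 \<le> p \<bullet> p" using inner_components[OF p(1-3) p(1-3)] p(4) by simp
    then have "norm p1 \<le> norm p" by (simp add: norm_le)
    then have "conjugate X1 \<phi> p1 < \<infinity>" using r(2)[OF p(1)] pr by auto
    then show "p \<in> D" using conjugate_eq[OF p(1-3)] p(4) p2 by (simp add: D_def edom_def)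
  qed
  have "0 \<in> W" by (simp add: W_def orthogonal_def)
  then have "0 \<in> D" using ball r(1) by auto
  then show ?thesis
    unfolding mem_rel_interior_ball D_def[symmetric] using ball hull r(1) by blast
qed

end

theorem lemma4p4p1:
  fixes \<Phi> \<phi> :: "real ^ 'n \<Rightarrow> ereal"
    and X1 X2 X3 :: "(real ^ 'n) set"
  assumes range: "\<And>x. \<Phi> x \<noteq> -\<infinity>"
    and decomp: "orthogonal_decomposition X1 X2 X3"
    and restriction: "\<And>x. x \<in> X1 \<Longrightarrow> \<phi> x = \<Phi> x"
    and structural: "\<And>x1 x2 x3. \<lbrakk>x1 \<in> X1; x2 \<in> X2; x3 \<in> X3\<rbrakk> \<Longrightarrow>
           \<Phi> (x1 + x2 + x3) = (if x3 = 0 then \<phi> x1 else \<infinity>)"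
    and dom_open: "openin (top_of_set X1) (edom X1 \<phi>)"
    and dom_zero: "0 \<in> closure (edom X1 \<phi>)"
    and proper: "proper_fun_on X1 \<phi>"
    and convex: "convex_fun_on X1 \<phi>"
    and lsc: "lsc_fun_on X1 \<phi>"
    and strictly_convex: "strictly_convex_fun_on (edom X1 \<phi>) \<phi>"
    and ess_smooth: "essentially_smooth_on X1 \<phi>"
    and minimizer: "\<exists>m\<in>X1. \<forall>y\<in>X1. \<phi> m \<le> \<phi> y"
  shows "(\<forall>x1\<in>X1. \<forall>x2\<in>X2. \<forall>x3\<in>X3.
            subdifferential UNIV \<Phi> (x1 + x2 + x3) =
              (if x3 = 0 then subdifferential X1 \<phi> x1 + {0} + X3 else {}))
       \<and> (\<forall>p1\<in>X1. \<forall>p2\<in>X2. \<forall>p3\<in>X3.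
            conjugate UNIV \<Phi> (p1 + p2 + p3) =
              (if p2 = 0 then conjugate X1 \<phi> p1 else \<infinity>))
       \<and> (proper_fun_on X1 (conjugate X1 \<phi>)
          \<and> convex_fun_on X1 (conjugate X1 \<phi>)
          \<and> lsc_fun_on X1 (conjugate X1 \<phi>)
          \<and> essentially_smooth_on X1 (conjugate X1 \<phi>)
          \<and> essentially_strictly_convex_on X1 (conjugate X1 \<phi>)
          \<and> 0 \<in> int_edom X1 (conjugate X1 \<phi>)
          \<and> 0 \<in> rel_interior (edom UNIV (conjugate UNIV \<Phi>)))"
proof -
  interpret strictly_convex_lsc X1 \<phi>
    using decomp proper convex lsc strictly_convex
    by unfold_locales (auto simp: orthogonal_decomposition_def)
  interpret P: partially_trivial_fun \<Phi> \<phi> X1 X2 X3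
    by unfold_locales (use decomp structural proper in auto)
  obtain m where m: "m \<in> X1" "\<And>y. y \<in> X1 \<Longrightarrow> \<phi> m \<le> \<phi> y" using minimizer by blast
  \<comment> \<open>A minimizer is a point with subgradient 0, and slopes that are subgradients
    somewhere are interior to the domain of the conjugate.\<close>
  have "0 \<in> subdifferential X1 \<phi> m"
    using m subspace by (auto simp: subdifferential_def subspace_0 zero_ereal_def[symmetric])
  then have zero: "0 \<in> int_edom X1 (conjugate X1 \<phi>)"
    using m(1) by (rule subdifferential_imp_int_edom_conjugate)
  then have "conjugate X1 \<phi> 0 < \<infinity>"
    unfolding int_edom_iff by auto
  then have "proper_fun_on X1 (conjugate X1 \<phi>)"
    using conjugate_not_minf P.zero_mem(1) unfolding proper_fun_on_def by blast
  moreover have "essentially_smooth_on X1 (conjugate X1 \<phi>)"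
    using zero by (intro conjugate_essentially_smooth) auto
  moreover have "essentially_strictly_convex_on X1 (conjugate X1 \<phi>)"
    using zero dom_open ess_smooth
    by (intro conjugate_essentially_strictly_convex) (auto simp: essentially_smooth_on_def)
  ultimately show ?thesis
    using P.subdifferential_eq P.conjugate_eq zero P.zero_rel_interior_edom_conjugate[OF zero]
      conjugate_convex[OF proper] conjugate_lsc by blast
qed

end
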